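(* Start with a stick of odd integer length $L>1$ and consider the discrete fragmentation process with stopping set $\mathfrak{S}=\{1\}\cup\{2m: m\in\mathbb{Z}_{>0}\}$; that is, a stick dies whenever its length is $1$ or even. Then for every base $B>1$ the distribution of lengths of all dead sticks at the end approaches strong Benford behavior base $B$ as $L\to\infty$ (through odd integers): if $P_L(s)$ is the proportion of dead sticks at the end whose length has base-$B$ significand at most $s$, then for every $s\in[1,B)$, $$\lim_{L\to\infty}\mathbb{E}[P_L(s)]=\log_B s,\qquad \lim_{L\to\infty}\operatorname{Var}[P_L(s)]=0 .$$
   Context: Significand: for $B>1$, each $x>0$ is written uniquely as $x=S_B(x)B^{j}$ with $S_B(x)\in[1,B)$, $j\in\mathbb{Z}$; $S_B(x)$ is the significand. Convergence to strong Benford behavior of random finite collections (counted with multiplicity) is by definition the pair of limits displayed in the claim for all $s\in[1,B)$. Discrete fragmentation process with starting length $L$ and stopping set $\mathfrak{S}\subseteq\mathbb{Z}_{>0}$, $L\notin\mathfrak{S}$: the starting stick, of integer length $L$, is alive. At each level, every living stick, of length $\ell$ say, is broken into two sticks of lengths $X$ and $\ell-X$, where $X$ is uniformly distributed on $\{1,\dots,\ell-1\}$, independently for different sticks. A new stick becomes dead (is never broken again) if its length is in $\mathfrak{S}$, and is alive otherwise. The process ends when all sticks are dead. *)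

theory Defs
  imports "HOL-Probability.Probability"
begin

definition significand :: "real \<Rightarrow> real \<Rightarrow> real" where
  "significand B x = (THE t. 1 \<le> t \<and> t < B \<and> (\<exists>j::int. x = t * B powi j))"

text \<open>
  The state of the process after a number of levels is the list of the lengths of all sticks,
  dead ones included; the order of the list carries no meaning.  A stick of length 1 cannot be
  broken, so the process is only meaningful for stopping sets containing 1
  (otherwise \<^term>\<open>pmf_of_set {}\<close> is an unspecified distribution).
\<close>

definition break_stick :: "nat set \<Rightarrow> nat \<Rightarrow> nat list pmf" where
  "break_stick S l =
     (if l \<in> S then return_pmf [l] else map_pmf (\<lambda>X. [X, l - X]) (pmf_of_set {1..l - 1}))"

primrec break_level :: "nat set \<Rightarrow> nat list \<Rightarrow> nat list pmf" where
  "break_level S [] = return_pmf []"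
| "break_level S (l # ls) =
     map_pmf (\<lambda>(xs, ys). xs @ ys) (pair_pmf (break_stick S l) (break_level S ls))"

primrec sticks_at_level :: "nat set \<Rightarrow> nat \<Rightarrow> nat \<Rightarrow> nat list pmf" where
  "sticks_at_level S L 0 = return_pmf [L]"
| "sticks_at_level S L (Suc n) = bind_pmf (sticks_at_level S L n) (break_level S)"

definition surely_ended :: "nat set \<Rightarrow> nat \<Rightarrow> nat \<Rightarrow> bool" where
  "surely_ended S L n \<longleftrightarrow> (\<forall>ls \<in> set_pmf (sticks_at_level S L n). set ls \<subseteq> S)"

text \<open>
  A collection of dead sticks does not change any more (\<open>break_level_dead\<close> below), so whatever
  the random level at which the process ends, its final collection is the one present at the first
  deterministic level by which it has ended on every trajectory.
  Such a level exists as soon as 1 is in the stopping set (\<open>surely_ended_ex\<close>).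
\<close>

definition dead_sticks :: "nat set \<Rightarrow> nat \<Rightarrow> nat list pmf" where
  "dead_sticks S L = sticks_at_level S L (LEAST n. surely_ended S L n)"

definition significand_proportion :: "real \<Rightarrow> real \<Rightarrow> nat list \<Rightarrow> real" where
  "significand_proportion B s ls =
     real (length (filter (\<lambda>l. significand B (real l) \<le> s) ls)) / real (length ls)"

lemma significand_ex1:
  fixes B x :: real
  assumes "B > 1" "x > 0"
  shows "\<exists>!t. 1 \<le> t \<and> t < B \<and> (\<exists>j::int. x = t * B powi j)"
proof (rule ex_ex1I)
  define j where "j = \<lfloor>log B x\<rfloor>"
  have pj: "B powi j = B powr real_of_int j"
    using assms by (simp add: powr_real_of_int')
  have "B powr real_of_int j \<le> x"
    using assms by (subst le_log_iff [symmetric]) (auto simp: j_def)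
  moreover have "x < B powr (real_of_int j + 1)"
    using assms by (subst log_less_iff [symmetric]) (auto simp: j_def)
  ultimately show "\<exists>t. 1 \<le> t \<and> t < B \<and> (\<exists>j::int. x = t * B powi j)"
    using assms
    by (intro exI [of _ "x / B powi j"] conjI exI [of _ j])
       (auto simp: pj powr_add field_simps)
next
  fix t u
  assume t: "1 \<le> t \<and> t < B \<and> (\<exists>j::int. x = t * B powi j)"
     and u: "1 \<le> u \<and> u < B \<and> (\<exists>j::int. x = u * B powi j)"
  have fl: "\<lfloor>log B x\<rfloor> = j" if "1 \<le> v" "v < B" "x = v * B powi j" for v and j :: int
  proof -
    have "x = v * B powr real_of_int j"
      using that assms by (simp add: powr_real_of_int')
    then have "log B x = log B v + real_of_int j"
      using that assms by (simp add: log_mult)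
    moreover have "0 \<le> log B v" "log B v < 1"
      using that assms by auto
    ultimately show ?thesis by linarith
  qed
  obtain i j :: int where "x = t * B powi i" "x = u * B powi j" using t u by blast
  moreover from this have "i = j" using fl t u by metis
  ultimately show "t = u" using assms by auto
qed

lemma significand_props:
  assumes "B > 1" "x > 0"
  shows "1 \<le> significand B x" "significand B x < B" "\<exists>j::int. x = significand B x * B powi j"
  using theI' [OF significand_ex1 [OF assms]] unfolding significand_def by blast+

lemma break_level_dead: "set ls \<subseteq> S \<Longrightarrow> break_level S ls = return_pmf ls"
  by (induction ls) (auto simp: break_stick_def pair_return_pmf1)

lemma set_break_level:
  assumes "ls' \<in> set_pmf (break_level S ls)" "x \<in> set ls'"
  shows "\<exists>l\<in>set ls. \<exists>xs\<in>set_pmf (break_stick S l). x \<in> set xs"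
  using assms by (induction ls arbitrary: ls') fastforce+

lemma break_stick_bound:
  assumes "xs \<in> set_pmf (break_stick S l)" "x \<in> set xs" "1 \<in> S" "l \<ge> 1"
  shows "1 \<le> x \<and> (x = l \<and> x \<in> S \<or> x < l)"
proof (cases "l \<in> S")
  case False
  with assms have "l \<ge> 2" by (cases "l = 1") auto
  then have "set_pmf (pmf_of_set {1..l - 1}) = {1..l - 1}" by (intro set_pmf_of_set) auto
  with False assms show ?thesis by (auto simp: break_stick_def)
qed (use assms in \<open>auto simp: break_stick_def\<close>)

lemma sticks_at_level_bound:
  assumes "1 \<in> S" "L \<ge> 1" "ls \<in> set_pmf (sticks_at_level S L n)" "x \<in> set ls"
  shows "1 \<le> x \<and> (x \<in> S \<or> x + n \<le> L)"
  using assms(3,4)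
proof (induction n arbitrary: ls x)
  case (Suc n)
  then obtain ls0 where ls0: "ls0 \<in> set_pmf (sticks_at_level S L n)"
    "ls \<in> set_pmf (break_level S ls0)" by auto
  then obtain l xs where l: "l \<in> set ls0" "xs \<in> set_pmf (break_stick S l)" "x \<in> set xs"
    using set_break_level Suc.prems by meson
  have "1 \<le> l \<and> (l \<in> S \<or> l + n \<le> L)" using Suc.IH ls0 l by blast
  then show ?case using break_stick_bound [OF l(2,3) assms(1)] l
    by (auto simp: break_stick_def split: if_splits)
qed (use assms in auto)

lemma surely_ended_level:
  assumes "1 \<in> S" "L \<ge> 1"
  shows "surely_ended S L L"
  unfolding surely_ended_def using sticks_at_level_bound [OF assms] by fastforce

lemma surely_ended_ex: "1 \<in> S \<Longrightarrow> L \<ge> 1 \<Longrightarrow> \<exists>n. surely_ended S L n"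
  using surely_ended_level by blast

lemma sticks_at_level_ended:
  assumes "surely_ended S L n"
  shows "sticks_at_level S L (n + k) = sticks_at_level S L n"
proof (induction k)
  case (Suc k)
  have "bind_pmf (sticks_at_level S L n) (break_level S)
          = bind_pmf (sticks_at_level S L n) return_pmf"
    using assms unfolding surely_ended_def
    by (intro bind_pmf_cong refl break_level_dead) auto
  with Suc show ?case by (simp add: bind_return_pmf')
qed auto

lemma dead_sticks_eq:
  assumes "surely_ended S L n"
  shows "dead_sticks S L = sticks_at_level S L n"
proof -
  define m where "m = (LEAST n. surely_ended S L n)"
  have "surely_ended S L m" "m \<le> n"
    using assms unfolding m_def by (auto intro: LeastI Least_le)
  then show ?thesis
    using sticks_at_level_ended [of S L m "n - m"] by (simp add: dead_sticks_def m_def)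
qed

lemma dead_sticks_dead:
  assumes "1 \<in> S" "L \<ge> 1" "ls \<in> set_pmf (dead_sticks S L)"
  shows "set ls \<subseteq> S"
  using assms surely_ended_level dead_sticks_eq unfolding surely_ended_def by metis

end

theory Submission
  imports Defs
begin

text \<open>
  An odd stick of length $2n+1$ breaks into one even and one odd piece, and the uniform choice of
  the cut makes the even piece $2d$ with $d$ uniform on $\{1,\dots,n\}$, leaving the odd piece
  $2(n-d)+1$.  So there is a single living stick at any time; every level sheds one dead stick
  $2d$, and the last living stick ends up as a dead stick of length $1$.  (The successive values
  $d$ are distributed like the cycle lengths of a uniform random permutation of $n$ points.)
  Hence, for a function $f$ of the length, the sum $F$ of $f$ over all dead sticks has expectation
  $f(1) + \sum_{d\le n} f(2d)/d$: each $d$ is hit $1/d$ times on average.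

  The variance of $F$ is only of the order of the harmonic number $H_n$ if $0 \le f \le 1$.  This
  comes from a supermartingale: assign to every stick the expected total $\varphi$ of $f$ that it
  will contribute and a bound $v$ for the variance of that contribution ($v = 3 H_m$ for an odd
  stick $2m+1$, $v = 0$ for an even one); then the expectation of
  $(\sum\varphi - c)^2 + \sum v$ over the current sticks never increases, for any constant $c$.
  See \<open>dead_sticks_quadratic\<close>, and \<open>one_step_quadratic\<close> for the inequality that makes
  it work.  At the end it says $E(F-c)^2 \le (EF-c)^2 + 3H_n$ (\<open>dead_sticks_second_moment\<close>).

  Use this for $f = 1$, where $F$ is the number $N$ of dead sticks, with expectation $H_n + 1$, and
  for the indicator $f$ of the event that the significand is at most $s$, where $F = P N$ with
  $P$ the proportion in question.  Both are concentrated on the scale $H_n$, hence so is their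
  quotient, and $E(P - \alpha)^2 \to 0$ for $\alpha = \log_B s$ as soon as
  $\sum_{d\le n} f(2d)/d = \alpha H_n + o(H_n)$ (\<open>dead_sticks_proportion_second_moment\<close>).  Convergence
  in mean square to a constant is the same as convergence of the expectation to it together with
  vanishing variance.

  The remaining asymptotics say that numbers of significand at most $s$ have logarithmic density
  $\alpha$ (\<open>significand_log_density\<close>).  With $y_d = \log_B(2d)$, the sum is essentially a
  Riemann sum for the integral of the 1-periodic indicator of $\{y.\ \mathrm{frac}(y)\le\alpha\}$
  up to $y_n$, because $\ln B\,(y_{d+1}-y_d) = \ln(1+1/d) \approx 1/d$.  It errs only where the
  indicator jumps between $y_d$ and $y_{d+1}$; there are $O(\log n)$ jumps, and the cost of each is
  $O(1/d)$, so that their total cost is $o(\log n)$.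
\<close>

section \<open>Expectations over finitely supported distributions\<close>

lemma expectation_bind_finite:
  fixes h :: "'b \<Rightarrow> real"
  assumes "finite (set_pmf p)" "\<And>x. x \<in> set_pmf p \<Longrightarrow> finite (set_pmf (q x))"
  shows "measure_pmf.expectation (bind_pmf p q) h
    = measure_pmf.expectation p (\<lambda>x. measure_pmf.expectation (q x) h)"
  using assms
  by (subst pmf_expectation_bind[where A = "set_pmf p"])
     (auto simp: integral_measure_pmf[where A = "set_pmf p"])

lemma expectation_mono_finite:
  fixes g h :: "'a \<Rightarrow> real"
  assumes "finite (set_pmf p)" "\<And>x. x \<in> set_pmf p \<Longrightarrow> g x \<le> h x"
  shows "measure_pmf.expectation p g \<le> measure_pmf.expectation p h"
  using assms by (intro integral_mono_AE integrable_measure_pmf_finite) (auto simp: AE_measure_pmf_iff)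

lemma finite_set_break_stick: "l \<in> S \<or> l \<ge> 2 \<Longrightarrow> finite (set_pmf (break_stick S l))"
  by (auto simp: break_stick_def)

lemma finite_set_break_level:
  "(\<And>l. l \<in> set ls \<Longrightarrow> l \<in> S \<or> l \<ge> 2) \<Longrightarrow> finite (set_pmf (break_level S ls))"
  by (induction ls) (auto simp: finite_set_break_stick)

lemma sticks_living_ge_2:
  assumes "1 \<in> S" "L \<ge> 1" "ls \<in> set_pmf (sticks_at_level S L n)" "l \<in> set ls"
  shows "l \<in> S \<or> l \<ge> 2"
  using sticks_at_level_bound[OF assms] assms(1) by (cases "l = 1") auto

lemma finite_set_sticks_at_level:
  assumes "1 \<in> S" "L \<ge> 1"
  shows "finite (set_pmf (sticks_at_level S L n))"
proof (induction n)
  case (Suc n)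
  then show ?case
    using sticks_living_ge_2[OF assms] by (fastforce intro!: finite_set_break_level)
qed auto

section \<open>A quadratic supermartingale\<close>

text \<open>
  Different sticks break independently, so variances add up: the property passes from single
  sticks to collections.  The constant $c$ has to be arbitrary, since in the induction the other
  sticks shift it by their own contribution.
\<close>

lemma break_level_quadratic:
  fixes \<phi> v :: "nat \<Rightarrow> real"
  assumes "\<And>l. l \<in> set ls \<Longrightarrow> l \<in> S \<or> l \<ge> 2"
    and "\<And>l c. l \<in> set ls \<Longrightarrow>
      measure_pmf.expectation (break_stick S l)
        (\<lambda>xs. (sum_list (map \<phi> xs) - c)\<^sup>2 + sum_list (map v xs)) \<le> (\<phi> l - c)\<^sup>2 + v l"
  shows "measure_pmf.expectation (break_level S ls)
        (\<lambda>xs. (sum_list (map \<phi> xs) - c)\<^sup>2 + sum_list (map v xs))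
      \<le> (sum_list (map \<phi> ls) - c)\<^sup>2 + sum_list (map v ls)"
  using assms
proof (induction ls arbitrary: c)
  case Nil
  then show ?case by simp
next
  case (Cons l ls)
  let ?A = "\<lambda>xs. sum_list (map \<phi> xs)" and ?V = "\<lambda>xs. sum_list (map v xs)"
  let ?p = "break_stick S l" and ?q = "break_level S ls"
  have fp: "finite (set_pmf ?p)" and fq: "finite (set_pmf ?q)"
    using Cons.prems(1) by (auto intro!: finite_set_break_stick finite_set_break_level)
  note [simp] = integrable_measure_pmf_finite[OF fp] integrable_measure_pmf_finite[OF fq]
  have "measure_pmf.expectation (break_level S (l # ls)) (\<lambda>xs. (?A xs - c)\<^sup>2 + ?V xs)
    = measure_pmf.expectation ?p (\<lambda>xs. measure_pmf.expectation ?q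
        (\<lambda>ys. (?A ys - (c - ?A xs))\<^sup>2 + ?V ys + ?V xs))"
    by (simp add: pair_pmf_def map_bind_pmf expectation_bind_finite fp fq algebra_simps)
  also have "\<dots> = measure_pmf.expectation ?p (\<lambda>xs. measure_pmf.expectation ?q
        (\<lambda>ys. (?A ys - (c - ?A xs))\<^sup>2 + ?V ys) + ?V xs)"
    by (subst Bochner_Integration.integral_add) auto
  also have "\<dots> \<le> measure_pmf.expectation ?p
        (\<lambda>xs. ((?A xs - (c - ?A ls))\<^sup>2 + ?V xs) + ?V ls)"
  proof (rule expectation_mono_finite[OF fp])
    fix xs
    have "measure_pmf.expectation ?q (\<lambda>ys. (?A ys - (c - ?A xs))\<^sup>2 + ?V ys)
        \<le> (?A ls - (c - ?A xs))\<^sup>2 + ?V ls"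
      using Cons.prems by (intro Cons.IH) auto
    then show "measure_pmf.expectation ?q (\<lambda>ys. (?A ys - (c - ?A xs))\<^sup>2 + ?V ys) + ?V xs
        \<le> ((?A xs - (c - ?A ls))\<^sup>2 + ?V xs) + ?V ls"
      by (simp add: algebra_simps)
  qed
  also have "\<dots> = measure_pmf.expectation ?p
        (\<lambda>xs. (?A xs - (c - ?A ls))\<^sup>2 + ?V xs) + ?V ls"
    by (subst Bochner_Integration.integral_add) auto
  also have "\<dots> \<le> (\<phi> l - (c - ?A ls))\<^sup>2 + v l + ?V ls"
    using Cons.prems(2)[of l "c - ?A ls"] by simp
  also have "\<dots> = (?A (l # ls) - c)\<^sup>2 + ?V (l # ls)"
    by (simp add: algebra_simps)
  finally show ?case .
qed

text \<open>
  Read \<open>\<phi> l\<close> as the expected final contribution of a stick of length $l$ and \<open>v l\<close> as a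
  bound for its variance.  The bias-variance decomposition makes the assumption plausible: the
  expected square around $c$ is the square of the bias plus the variance, and what a break adds to
  the square must be paid for by the decrease of \<open>v\<close>.  Dead sticks do not change and satisfy
  it trivially.
\<close>

lemma dead_sticks_quadratic:
  fixes \<phi> v :: "nat \<Rightarrow> real"
  assumes "1 \<in> S" "L \<ge> 1"
    and step: "\<And>l c. l \<notin> S \<Longrightarrow> l \<ge> 2 \<Longrightarrow>
      measure_pmf.expectation (break_stick S l)
        (\<lambda>xs. (sum_list (map \<phi> xs) - c)\<^sup>2 + sum_list (map v xs)) \<le> (\<phi> l - c)\<^sup>2 + v l"
  shows "measure_pmf.expectation (dead_sticks S L)
        (\<lambda>xs. (sum_list (map \<phi> xs) - c)\<^sup>2 + sum_list (map v xs)) \<le> (\<phi> L - c)\<^sup>2 + v L"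
proof -
  let ?Q = "\<lambda>xs. (sum_list (map \<phi> xs) - c)\<^sup>2 + sum_list (map v xs)"
  have "measure_pmf.expectation (sticks_at_level S L n) ?Q \<le> (\<phi> L - c)\<^sup>2 + v L" for n
  proof (induction n)
    case (Suc n)
    let ?p = "sticks_at_level S L n"
    have living: "l \<in> S \<or> l \<ge> 2" if "ls \<in> set_pmf ?p" "l \<in> set ls" for l ls
      using sticks_living_ge_2[OF assms(1,2)] that by blast
    have one_stick: "measure_pmf.expectation (break_stick S l)
        (\<lambda>xs. (sum_list (map \<phi> xs) - c)\<^sup>2 + sum_list (map v xs)) \<le> (\<phi> l - c)\<^sup>2 + v l"
      if "l \<in> S \<or> l \<ge> 2" for l c
      using that step by (cases "l \<in> S") (auto simp: break_stick_def)
    have "measure_pmf.expectation (sticks_at_level S L (Suc n)) ?Q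
        = measure_pmf.expectation ?p (\<lambda>ls. measure_pmf.expectation (break_level S ls) ?Q)"
      using living finite_set_sticks_at_level[OF assms(1,2)]
      by (simp add: expectation_bind_finite finite_set_break_level)
    also have "\<dots> \<le> measure_pmf.expectation ?p ?Q"
      using living one_stick finite_set_sticks_at_level[OF assms(1,2)]
      by (intro expectation_mono_finite break_level_quadratic) blast+
    also note Suc.IH
    finally show ?case .
  qed simp
  then show ?thesis
    unfolding dead_sticks_def .
qed

section \<open>One step from an odd length\<close>

text \<open>
  This is the statement that $m_n = a + \sum_{d\le n} g_d/d$ solves the first-step equation of the
  expected total, if the stick $n$ sheds $d$, uniform on $\{1,\dots,n\}$, with reward $g_d$ and
  continues as $n - d$.
\<close>

lemma sum_plus_partial_harmonic_sums:
  fixes g :: "nat \<Rightarrow> real" and a :: real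
  defines "m \<equiv> \<lambda>n. a + (\<Sum>d = 1..n. g d / real d)"
  shows "(\<Sum>d = 1..n. g d + m (n - d)) = real n * m n"
proof -
  have "(\<Sum>d = 1..n. g d) + (\<Sum>k<n. m k) = real n * m n"
  proof (induction n)
    case (Suc n)
    have "real (Suc n) * m (Suc n) = real (Suc n) * m n + g (Suc n)"
      by (simp add: m_def field_simps)
    with Suc.IH show ?case by (simp add: algebra_simps)
  qed simp
  moreover have "(\<Sum>d = 1..n. m (n - d)) = (\<Sum>k<n. m k)"
    by (rule sum.reindex_bij_witness[of _ "\<lambda>k. n - k" "\<lambda>d. n - d"]) auto
  ultimately show ?thesis by (simp add: sum.distrib)
qed

lemma sum_harm: "(\<Sum>k<n. harm k :: real) = real n * harm n - real n"
  by (induction n) (simp_all add: harm_Suc algebra_simps, simp add: field_simps)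

text \<open>
  The discrete version of $\int_0^1 (\ln x)^2\,dx = 2$: one break changes the harmonic number of
  the living stick by an amount of bounded mean square.
\<close>

lemma sum_harm_deviation_squared:
  "(\<Sum>k<n. (harm n - harm k :: real)\<^sup>2) \<le> 2 * real n"
proof (induction n)
  case (Suc n)
  let ?c = "1 / (real n + 1)"
  have "(\<Sum>k<Suc n. (harm (Suc n) - harm k :: real)\<^sup>2)
      = (\<Sum>k<n. (harm n - harm k)\<^sup>2 + 2 * ?c * (harm n - harm k) + ?c\<^sup>2) + ?c\<^sup>2"
    by (simp add: harm_Suc inverse_eq_divide power2_eq_square algebra_simps diff_divide_distrib)
  also have "\<dots> = (\<Sum>k<n. (harm n - harm k)\<^sup>2) + 2 * ?c * real n + (real n + 1) * ?c\<^sup>2"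
    by (simp only: sum.distrib sum_distrib_left[symmetric] sum_subtractf sum_harm)
       (simp add: algebra_simps)
  also have "(real n + 1) * ?c\<^sup>2 = ?c"
    by (simp add: power2_eq_square)
  also have "(\<Sum>k<n. (harm n - harm k)\<^sup>2) + 2 * ?c * real n + ?c \<le> 2 * real n + 2"
  proof -
    have "2 * ?c * real n + ?c \<le> 2" by (simp add: field_simps)
    with Suc.IH show ?thesis by linarith
  qed
  finally show ?case by simp
qed simp

text \<open>
  Split the square at the mean $m_n$.  The fluctuation $g_d + m_{n-d} - m_n$ is a reward in $[0,1]$
  minus a loss between $0$ and $H_n - H_{n-d}$, so its mean square is at most $1 + 2$ by
  \<open>sum_harm_deviation_squared\<close>.  On the other hand the average of $H_{n-d}$ is exactly
  $H_n - 1$, so the term $3H$ falls by $3$ on average, which pays for the fluctuation.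
\<close>

lemma one_step_quadratic:
  fixes g :: "nat \<Rightarrow> real" and a c :: real
  assumes g: "\<And>d. 0 \<le> g d" "\<And>d. g d \<le> 1"
  defines "m \<equiv> \<lambda>n. a + (\<Sum>d = 1..n. g d / real d)"
  shows "(\<Sum>d = 1..n. (g d + m (n - d) - c)\<^sup>2 + 3 * harm (n - d))
    \<le> real n * ((m n - c)\<^sup>2 + 3 * harm n)"
proof -
  have centred: "(\<Sum>d = 1..n. g d + m (n - d) - m n) = 0"
    using sum_plus_partial_harmonic_sums[of g a n] unfolding m_def by (simp only: sum_subtractf) simp
  have spread: "(g d + m (n - d) - m n)\<^sup>2 \<le> 1 + (harm n - harm (n - d))\<^sup>2" if "d \<in> {1..n}" for d
  proof -
    have split: "(\<Sum>e = 1..n. u e) = (\<Sum>e = 1..n - d. u e) + (\<Sum>e = Suc (n - d)..n. u e)"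
      for u :: "nat \<Rightarrow> real"
      using that by (subst sum.union_disjoint[symmetric]) (auto intro!: sum.cong)
    have "m n - m (n - d) = (\<Sum>e = Suc (n - d)..n. g e / real e)"
      using split[of "\<lambda>e. g e / real e"] by (simp add: m_def)
    moreover have "harm n - harm (n - d) = (\<Sum>e = Suc (n - d)..n. 1 / real e)"
      using split[of "\<lambda>e. 1 / real e"] by (simp add: harm_def inverse_eq_divide)
    moreover have "(\<Sum>e = Suc (n - d)..n. g e / real e) \<le> (\<Sum>e = Suc (n - d)..n. 1 / real e)"
      using g by (intro sum_mono divide_right_mono) auto
    moreover have "0 \<le> (\<Sum>e = Suc (n - d)..n. g e / real e)"
      using g by (intro sum_nonneg) auto
    ultimately have "0 \<le> m n - m (n - d)" "m n - m (n - d) \<le> harm n - harm (n - d)"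
      by simp_all
    moreover have "(x - y)\<^sup>2 \<le> 1 + z\<^sup>2" if "0 \<le> x" "x \<le> 1" "0 \<le> y" "y \<le> z" for x y z :: real
    proof -
      have "x\<^sup>2 \<le> 1" "y\<^sup>2 \<le> z\<^sup>2" "0 \<le> x * y"
        using that by (auto simp: power_le_one power_mono)
      then show ?thesis by (simp add: power2_diff)
    qed
    ultimately show ?thesis
      using g[of d] by (smt (verit))
  qed
  have "(\<Sum>d = 1..n. (g d + m (n - d) - c)\<^sup>2)
      = (\<Sum>d = 1..n. (g d + m (n - d) - m n)\<^sup>2 + 2 * (m n - c) * (g d + m (n - d) - m n) + (m n - c)\<^sup>2)"
    by (intro sum.cong refl) (simp add: power2_eq_square algebra_simps)
  also have "\<dots> = (\<Sum>d = 1..n. (g d + m (n - d) - m n)\<^sup>2) + real n * (m n - c)\<^sup>2"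
    by (simp only: sum.distrib sum_distrib_left[symmetric] centred) simp
  also have "\<dots> \<le> (\<Sum>d = 1..n. 1 + (harm n - harm (n - d))\<^sup>2) + real n * (m n - c)\<^sup>2"
    using spread by (intro add_right_mono sum_mono) auto
  also have "(\<Sum>d = 1..n. 1 + (harm n - harm (n - d) :: real)\<^sup>2)
      = real n + (\<Sum>k<n. (harm n - harm k)\<^sup>2)"
    using sum.reindex_bij_witness[of "{1..n}" "\<lambda>k. n - k" "\<lambda>d. n - d" "{..<n}"
        "\<lambda>k. (harm n - harm k :: real)\<^sup>2"]
    by (auto simp: sum.distrib)
  also have "\<dots> \<le> 3 * real n"
    using sum_harm_deviation_squared[of n] by simp
  finally have square: "(\<Sum>d = 1..n. (g d + m (n - d) - c)\<^sup>2) \<le> 3 * real n + real n * (m n - c)\<^sup>2"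
    by simp
  have "(\<Sum>d = 1..n. harm (n - d) :: real) = (\<Sum>k<n. harm k)"
    by (rule sum.reindex_bij_witness[of _ "\<lambda>k. n - k" "\<lambda>d. n - d"]) auto
  then have "(\<Sum>d = 1..n. 3 * harm (n - d) :: real) = 3 * (real n * harm n - real n)"
    by (simp add: sum_harm sum_distrib_left[symmetric])
  with square show ?thesis
    by (simp add: sum.distrib algebra_simps)
qed

lemma sum_over_splits_of_odd:
  fixes h :: "nat \<Rightarrow> nat \<Rightarrow> real"
  assumes sym: "\<And>x y. h x y = h y x"
  shows "(\<Sum>X = 1..2 * n. h X (2 * n + 1 - X)) = 2 * (\<Sum>d = 1..n. h (2 * d) (2 * (n - d) + 1))"
proof -
  have parity: "(\<Sum>X = 1..2 * n. u X) = (\<Sum>d = 1..n. u (2 * d)) + (\<Sum>d = 1..n. u (2 * d - 1))"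
    for u :: "nat \<Rightarrow> real"
    by (induction n) auto
  have "(\<Sum>d = 1..n. h (2 * d - 1) (2 * n + 1 - (2 * d - 1)))
      = (\<Sum>d = 1..n. h (2 * d) (2 * n + 1 - 2 * d))"
    by (rule sum.reindex_bij_witness[of _ "\<lambda>d. n + 1 - d" "\<lambda>d. n + 1 - d"])
       (auto simp: sym algebra_simps intro!: arg_cong2[where f = h])
  then have "(\<Sum>X = 1..2 * n. h X (2 * n + 1 - X)) = 2 * (\<Sum>d = 1..n. h (2 * d) (2 * n + 1 - 2 * d))"
    unfolding parity by simp
  also have "(\<Sum>d = 1..n. h (2 * d) (2 * n + 1 - 2 * d)) = (\<Sum>d = 1..n. h (2 * d) (2 * (n - d) + 1))"
    by (intro sum.cong refl arg_cong2[where f = h]) auto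
  finally show ?thesis .
qed

text \<open>
  The expected sum of \<open>f\<close> over the dead sticks into which a stick of length \<open>l\<close> decays.
  The case distinction is by parity, not by death: for the dead odd length 1 the sum is empty and
  the formula gives \<open>f 1\<close>.
\<close>

definition expected_total :: "(nat \<Rightarrow> real) \<Rightarrow> nat \<Rightarrow> real" where
  "expected_total f l = (if even l then f l else f 1 + (\<Sum>d = 1..l div 2. f (2 * d) / real d))"

definition variance_bound :: "nat \<Rightarrow> real" where
  "variance_bound l = (if even l then 0 else 3 * harm (l div 2))"

text \<open>
  Every cut of $2n+1$ has exactly one even piece, and each $d \in \{1,\dots,n\}$ arises from two
  cuts, according to which of the two pieces is the even one; so the average over all cuts is the
  average over $d$ treated in \<open>one_step_quadratic\<close>.
\<close>

lemma break_odd_stick_quadratic: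
  fixes f :: "nat \<Rightarrow> real"
  assumes f: "\<And>l. 0 \<le> f l" "\<And>l. f l \<le> 1"
    and "odd l" "l \<ge> 2" "l \<notin> S"
  shows "measure_pmf.expectation (break_stick S l)
        (\<lambda>xs. (sum_list (map (expected_total f) xs) - c)\<^sup>2 + sum_list (map variance_bound xs))
      \<le> (expected_total f l - c)\<^sup>2 + variance_bound l"
proof -
  obtain n where l: "l = 2 * n + 1" using \<open>odd l\<close> oddE by blast
  with \<open>l \<ge> 2\<close> have n: "n > 0" by simp
  define h where "h x y = (expected_total f x + expected_total f y - c)\<^sup>2
    + (variance_bound x + variance_bound y)" for x y
  have "measure_pmf.expectation (break_stick S l)
        (\<lambda>xs. (sum_list (map (expected_total f) xs) - c)\<^sup>2 + sum_list (map variance_bound xs))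
      = (\<Sum>X = 1..2 * n. h X (2 * n + 1 - X)) / real (2 * n)"
    using n \<open>l \<notin> S\<close> unfolding break_stick_def h_def
    by (simp add: integral_pmf_of_set l)
  also have "\<dots> = (\<Sum>d = 1..n. h (2 * d) (2 * (n - d) + 1)) / real n"
    by (subst sum_over_splits_of_odd) (auto simp: h_def algebra_simps)
  also have "\<dots> \<le> (expected_total f l - c)\<^sup>2 + variance_bound l"
    using one_step_quadratic[of "\<lambda>d. f (2 * d)" "f 1" n c] f n
    by (simp add: h_def expected_total_def variance_bound_def l field_simps)
  finally show ?thesis .
qed

text \<open>
  On a collection of dead sticks, the expected total is the actual total and the variance bound
  vanishes, so that the supermartingale ends at $(F - c)^2$.
\<close>

lemma dead_sticks_second_moment:
  fixes f :: "nat \<Rightarrow> real"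
  assumes S: "S = {1} \<union> {2 * m | m. m > 0}"
    and f: "\<And>l. 0 \<le> f l" "\<And>l. f l \<le> 1" and "odd L"
  shows "measure_pmf.expectation (dead_sticks S L) (\<lambda>ls. (sum_list (map f ls) - c)\<^sup>2)
    \<le> (f 1 + (\<Sum>d = 1..L div 2. f (2 * d) / real d) - c)\<^sup>2 + 3 * harm (L div 2)"
proof -
  have S1: "1 \<in> S" and L: "L \<ge> 1"
    using S odd_pos[OF \<open>odd L\<close>] by auto
  have dead: "expected_total f l = f l" "variance_bound l = 0" if "l \<in> S" for l
    using that by (auto simp: S expected_total_def variance_bound_def harm_def)
  have living: "odd l" if "l \<notin> S" "l \<ge> 2" for l
    using that by (auto simp: S elim!: evenE)
  have "measure_pmf.expectation (dead_sticks S L) (\<lambda>ls. (sum_list (map f ls) - c)\<^sup>2)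
      = measure_pmf.expectation (dead_sticks S L) (\<lambda>ls.
          (sum_list (map (expected_total f) ls) - c)\<^sup>2 + sum_list (map variance_bound ls))"
  proof (intro integral_cong_AE)
    show "AE ls in dead_sticks S L. (sum_list (map f ls) - c)\<^sup>2 =
        (sum_list (map (expected_total f) ls) - c)\<^sup>2 + sum_list (map variance_bound ls)"
    proof (rule AE_pmfI)
      fix ls assume "ls \<in> set_pmf (dead_sticks S L)"
      then have "\<forall>l \<in> set ls. l \<in> S" using dead_sticks_dead[OF S1 L] by blast
      then have "map (expected_total f) ls = map f ls" "map variance_bound ls = map (\<lambda>_. 0) ls"
        using dead by (auto cong: map_cong)
      then show "(sum_list (map f ls) - c)\<^sup>2 =
          (sum_list (map (expected_total f) ls) - c)\<^sup>2 + sum_list (map variance_bound ls)"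
        by (simp only:) simp
    qed
  qed auto
  also have "\<dots> \<le> (expected_total f L - c)\<^sup>2 + variance_bound L"
    using f living by (intro dead_sticks_quadratic[OF S1 L] break_odd_stick_quadratic) auto
  finally show ?thesis
    using \<open>odd L\<close> by (simp add: expected_total_def variance_bound_def)
qed

section \<open>Logarithmic density\<close>

lemma significand_le_iff:
  assumes "B > 1" "x > 0" "s \<in> {1..<B}"
  shows "significand B x \<le> s \<longleftrightarrow> frac (log B x) \<le> log B s"
proof -
  let ?t = "significand B x"
  obtain j :: int where t: "1 \<le> ?t" "?t < B" "x = ?t * B powi j"
    using significand_props[OF assms(1,2)] by blast
  have "log B (?t * B powi j) = log B ?t + real_of_int j"
    using t(1,2) assms(1) by (simp add: log_mult powr_real_of_int'[symmetric])
  then have "log B x = log B ?t + real_of_int j"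
    using t(3) by metis
  moreover have "0 \<le> log B ?t" "log B ?t < 1"
    using t assms(1) by auto
  ultimately have "frac (log B x) = log B ?t"
    by (simp add: frac_unique_iff)
  moreover have "log B ?t \<le> log B s \<longleftrightarrow> ?t \<le> s"
    using t assms by simp
  ultimately show ?thesis by simp
qed

text \<open>
  The integral from $0$ to $y$ of the 1-periodic indicator of $\{t.\ \mathrm{frac}(t)\le\alpha\}$.
\<close>

definition phase_measure :: "real \<Rightarrow> real \<Rightarrow> real" where
  "phase_measure \<alpha> y = \<alpha> * of_int \<lfloor>y\<rfloor> + min (frac y) \<alpha>"

text \<open>
  A count of the jumps of this indicator up to $y$: it switches on at the integers and off after
  the points of $\alpha + \mathbb{Z}$.
\<close>

definition phase_jumps :: "real \<Rightarrow> real \<Rightarrow> real" where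
  "phase_jumps \<alpha> y = of_int \<lfloor>y\<rfloor> + of_int \<lceil>y - \<alpha>\<rceil>"

lemma phase_jumps_mono: "y \<le> z \<Longrightarrow> phase_jumps \<alpha> y \<le> phase_jumps \<alpha> z"
  unfolding phase_jumps_def by (intro add_mono) (auto intro: floor_mono ceiling_mono)

lemma phase_measure_increment:
  assumes \<alpha>: "0 \<le> \<alpha>" "\<alpha> \<le> 1" and "y \<le> z"
  shows "0 \<le> phase_measure \<alpha> z - phase_measure \<alpha> y"
    and "phase_measure \<alpha> z - phase_measure \<alpha> y \<le> z - y"
proof -
  have y: "y = of_int \<lfloor>y\<rfloor> + frac y" and z: "z = of_int \<lfloor>z\<rfloor> + frac z"
    by (auto simp: frac_def)
  have fr: "0 \<le> frac y" "frac y < 1" "0 \<le> frac z" "frac z < 1"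
    by (auto simp: frac_lt_1)
  \<comment> \<open>In the second case compare at the integer $\lfloor z\rfloor$, up to which the indicator and
    its complement have integrals $\alpha\lfloor z\rfloor$ and $(1-\alpha)\lfloor z\rfloor$.\<close>
  consider "\<lfloor>y\<rfloor> = \<lfloor>z\<rfloor>" | "\<lfloor>y\<rfloor> + 1 \<le> \<lfloor>z\<rfloor>"
    using floor_mono[OF \<open>y \<le> z\<close>] by linarith
  then have "0 \<le> phase_measure \<alpha> z - phase_measure \<alpha> y
      \<and> phase_measure \<alpha> z - phase_measure \<alpha> y \<le> z - y"
  proof cases
    case 1
    then show ?thesis
      using \<open>y \<le> z\<close> y z unfolding phase_measure_def by (auto simp: min_def)
  next
    case 2
    then have "\<alpha> * (of_int \<lfloor>y\<rfloor> + 1) \<le> \<alpha> * of_int \<lfloor>z\<rfloor>"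
      and "(1 - \<alpha>) * (of_int \<lfloor>y\<rfloor> + 1) \<le> (1 - \<alpha>) * of_int \<lfloor>z\<rfloor>"
      using \<alpha> by (auto intro!: mult_left_mono)
    then have "\<alpha> * of_int \<lfloor>y\<rfloor> + \<alpha> \<le> \<alpha> * of_int \<lfloor>z\<rfloor>"
      and "of_int \<lfloor>y\<rfloor> - \<alpha> * of_int \<lfloor>y\<rfloor> + (1 - \<alpha>) \<le> of_int \<lfloor>z\<rfloor> - \<alpha> * of_int \<lfloor>z\<rfloor>"
      by (simp_all add: algebra_simps)
    moreover have "min (frac y) \<alpha> \<le> \<alpha>" "frac y - min (frac y) \<alpha> \<le> 1 - \<alpha>"
      "0 \<le> min (frac z) \<alpha>" "min (frac z) \<alpha> \<le> frac z"
      using fr \<alpha> by (auto simp: min_def)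
    ultimately show ?thesis
      using y z unfolding phase_measure_def by (intro conjI; linarith)
  qed
  then show "0 \<le> phase_measure \<alpha> z - phase_measure \<alpha> y"
    and "phase_measure \<alpha> z - phase_measure \<alpha> y \<le> z - y" by auto
qed

text \<open>
  Without a jump between $y$ and $z$ the indicator is constant there and its integral is exactly
  the length times the value; with a jump, the error is at most the length $z - y$.
\<close>

lemma phase_measure_approx:
  assumes \<alpha>: "0 \<le> \<alpha>" "\<alpha> < 1" and "y \<le> z"
  shows "\<bar>of_bool (frac y \<le> \<alpha>) * (z - y) - (phase_measure \<alpha> z - phase_measure \<alpha> y)\<bar>
    \<le> (z - y) * (phase_jumps \<alpha> z - phase_jumps \<alpha> y)"
proof (cases "\<lfloor>y\<rfloor> = \<lfloor>z\<rfloor> \<and> \<lceil>y - \<alpha>\<rceil> = \<lceil>z - \<alpha>\<rceil>")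
  case True
  have ceil: "\<lceil>x - \<alpha>\<rceil> = (if frac x \<le> \<alpha> then \<lfloor>x\<rfloor> else \<lfloor>x\<rfloor> + 1)" for x
    using \<alpha> frac_lt_1[of x] frac_ge_0[of x] of_int_floor_le[of x] by (simp add: ceiling_eq_iff frac_def, linarith)
  have "frac y \<le> \<alpha> \<longleftrightarrow> frac z \<le> \<alpha>"
    using True ceil[of y] ceil[of z] by (auto split: if_splits)
  moreover have "frac z - frac y = z - y"
    using True by (simp add: frac_def)
  ultimately show ?thesis
    using True by (auto simp: phase_measure_def phase_jumps_def)
next
  case False
  have "1 \<le> phase_jumps \<alpha> z - phase_jumps \<alpha> y"
    using False floor_mono[OF \<open>y \<le> z\<close>] ceiling_mono[of "y - \<alpha>" "z - \<alpha>"] \<open>y \<le> z\<close>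
    unfolding phase_jumps_def by linarith
  then have "z - y \<le> (z - y) * (phase_jumps \<alpha> z - phase_jumps \<alpha> y)"
    using \<open>y \<le> z\<close> mult_left_mono[of 1 _ "z - y"] by simp
  then show ?thesis
    using phase_measure_increment[of \<alpha> y z] assms by auto
qed

text \<open>
  Weights tending to zero make a sum of order $l$ negligible against $l$: up to an index $M$ the sum
  is a constant, and beyond $M$ the weights are at most $1/M$, so that the increments telescope to
  at most $C\,l_n/M$.
\<close>

lemma sum_increments_div_smallo:
  fixes V l :: "nat \<Rightarrow> real"
  assumes V: "\<And>n. n \<ge> 1 \<Longrightarrow> V n \<le> V (Suc n)" "\<And>n. V (Suc n) \<le> C * l n"
    and l: "filterlim l at_top sequentially"
  shows "(\<lambda>n. (\<Sum>d = 1..n. (V (Suc d) - V d) / real d) / l n) \<longlonglongrightarrow> 0"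
proof (rule tendstoI)
  fix e :: real assume "e > 0"
  define T where "T n = (\<Sum>d = 1..n. (V (Suc d) - V d) / real d)" for n
  obtain M :: nat where M: "real M > 2 * (\<bar>C\<bar> + 1) / e" "M > 0"
    using reals_Archimedean2[of "max 0 (2 * (\<bar>C\<bar> + 1) / e)"] by auto
  have tail: "T n \<le> T M + (V (Suc n) - V (Suc M)) / real M" if "n \<ge> M" for n
    using that
  proof (induction n rule: dec_induct)
    case (step n)
    have "(V (Suc (Suc n)) - V (Suc n)) / real (Suc n) \<le> (V (Suc (Suc n)) - V (Suc n)) / real M"
      using step V(1)[of "Suc n"] M(2) by (intro divide_left_mono) auto
    with step.IH show ?case by (simp add: T_def diff_divide_distrib)
  qed simp
  have T0: "0 \<le> T n" for n
    unfolding T_def using V by (intro sum_nonneg) auto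
  define D where "D = \<bar>T M\<bar> + \<bar>V (Suc M)\<bar> / real M"
  have "\<forall>\<^sub>F n in sequentially. l n \<ge> max 1 (2 * D / e + 1)"
    using l unfolding filterlim_at_top by blast
  then have "\<forall>\<^sub>F n in sequentially. dist (T n / l n) 0 < e"
    using eventually_ge_at_top[of M]
  proof eventually_elim
    case (elim n)
    then have l1: "l n \<ge> 1" "l n > 2 * D / e" by auto
    have "T n \<le> D + C * l n / real M"
    proof -
      have "V (Suc n) / real M \<le> C * l n / real M"
        using V(2)[of n] M(2) by (simp add: divide_right_mono)
      moreover have "- V (Suc M) / real M \<le> \<bar>V (Suc M)\<bar> / real M"
        by (intro divide_right_mono) auto
      ultimately show ?thesis
        using tail[OF elim(2)] unfolding D_def by (simp add: diff_divide_distrib)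
    qed
    moreover have "D < e / 2 * l n"
      using l1 \<open>e > 0\<close> by (simp add: field_simps)
    moreover have "C * l n / real M \<le> e / 2 * l n"
    proof -
      have "C / real M \<le> e / 2"
        using M \<open>e > 0\<close> by (simp add: field_simps)
      then show ?thesis using l1 mult_right_mono[of "C / real M" "e / 2" "l n"] by simp
    qed
    ultimately have "T n < e * l n" by linarith
    then show ?case using l1 T0[of n] by (simp add: field_simps)
  qed
  then show "\<forall>\<^sub>F n in sequentially. dist ((\<Sum>d = 1..n. (V (Suc d) - V d) / real d) / l n) 0 < e"
    by (simp add: T_def)
qed

text \<open>
  Compare the $d$-th term with the increment from $y_d$ to $y_{d+1}$ of $\ln B$ times
  \<open>phase_measure \<alpha> y - \<alpha> * y\<close>, a function of period 1 and therefore bounded.  The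
  difference has two sources: the error of $1/d \approx \ln(1+1/d)$, which is at most $1/d^2$, and
  the jumps of the indicator.  Both have the form $1/d$ times the increment of a nondecreasing
  sequence $V$ of order $H_n$: the harmonic numbers for the first, the jump count for the second.
\<close>

lemma significand_log_density:
  assumes "B > 1" "s \<in> {1..<B}"
  shows "(\<lambda>n. (\<Sum>d = 1..n. (of_bool (significand B (2 * real d) \<le> s) - log B s) / real d)
            / (harm n + 1)) \<longlonglongrightarrow> 0"
proof -
  define \<alpha> where "\<alpha> = log B s"
  have \<alpha>: "0 \<le> \<alpha>" "\<alpha> < 1" using assms by (auto simp: \<alpha>_def)
  have lnB: "ln B > 0" using assms by simp
  define y where "y d = log B (2 * real d)" for d :: nat
  define h where "h d = (of_bool (frac (y d) \<le> \<alpha>) :: real)" for d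
  define K where "K d = phase_measure \<alpha> (y d) - \<alpha> * y d" for d
  define V where "V d = phase_jumps \<alpha> (y d) + harm (d - 1)" for d
  define D where "D n = (\<Sum>d = 1..n. (h d - \<alpha>) / real d)" for n
  define T where "T n = (\<Sum>d = 1..n. (V (Suc d) - V d) / real d)" for n
  have step_y: "ln B * (y (Suc d) - y d) = ln (1 + 1 / real d)" if "d \<ge> 1" for d
  proof -
    have "ln (1 + 1 / real d) = ln (2 * real (Suc d) / (2 * real d))"
      using that by (intro arg_cong[where f = ln]) (simp add: field_simps)
    then show ?thesis
      using that lnB by (simp add: ln_div y_def log_def right_diff_distrib)
  qed
  have y_mono: "y d \<le> y (Suc d)" if "d \<ge> 1" for d
    using that assms by (simp add: y_def)
  have increment: "\<bar>(h d - \<alpha>) / real d - ln B * (K (Suc d) - K d)\<bar> \<le> (V (Suc d) - V d) / real d"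
    if d: "d \<ge> 1" for d
  proof -
    let ?l = "ln (1 + 1 / real d)"
    have l: "?l \<le> 1 / real d" "1 / real d - ?l \<le> (1 / real d) * (1 / real d)" "0 \<le> ?l"
    proof -
      show "?l \<le> 1 / real d" "0 \<le> ?l" using ln_add_one_self_le_self[of "1 / real d"] by auto
      have "- ?l = ln (1 / (1 + 1 / real d))" using d by (simp add: ln_div add_pos_pos)
      also have "\<dots> \<le> 1 / (1 + 1 / real d) - 1" using d by (intro ln_le_minus_one) (auto simp: add_pos_pos)
      also have "1 / (1 + 1 / real d) - 1 = - (1 / (real d + 1))" using d by (simp add: field_simps)
      finally have "1 / real d - ?l \<le> 1 / real d - 1 / (real d + 1)" by linarith
      also have "\<dots> = (1 / real d) * (1 / (real d + 1))"
        using d by (simp add: field_simps)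
      also have "\<dots> \<le> (1 / real d) * (1 / real d)"
        using d by (intro mult_left_mono divide_left_mono) auto
      finally show "1 / real d - ?l \<le> (1 / real d) * (1 / real d)" .
    qed
    let ?w = "phase_jumps \<alpha> (y (Suc d)) - phase_jumps \<alpha> (y d)"
    let ?r = "h d * (y (Suc d) - y d) - (phase_measure \<alpha> (y (Suc d)) - phase_measure \<alpha> (y d))"
    have "ln B * \<bar>?r\<bar> \<le> ln B * ((y (Suc d) - y d) * ?w)"
      using phase_measure_approx[OF \<alpha> y_mono[OF d]] lnB
      by (intro mult_left_mono) (auto simp: h_def)
    also have "\<dots> = ?l * ?w"
      using step_y[OF d] by (simp add: mult.assoc[symmetric])
    also have "\<dots> \<le> 1 / real d * ?w"
      using l phase_jumps_mono[OF y_mono[OF d]] by (intro mult_right_mono) auto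
    finally have jump: "\<bar>ln B * ?r\<bar> \<le> 1 / real d * ?w"
      using lnB by (simp add: abs_mult)
    have "\<bar>(h d - \<alpha>) * (1 / real d - ?l)\<bar> \<le> 1 * (1 / real d - ?l)"
      unfolding abs_mult using \<alpha> l by (intro mult_mono) (auto simp: h_def)
    also have "\<dots> \<le> 1 / real d * (1 / real d)" using l by simp
    finally have smooth: "\<bar>(h d - \<alpha>) * (1 / real d - ?l)\<bar> \<le> 1 / real d * (1 / real d)" .
    have "(h d - \<alpha>) / real d - ln B * (K (Suc d) - K d)
        = (h d - \<alpha>) * (1 / real d - ?l) + ln B * ?r"
      unfolding step_y[OF d, symmetric] K_def by (simp add: algebra_simps)
    also have "\<bar>\<dots>\<bar> \<le> 1 / real d * (1 / real d) + 1 / real d * ?w"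
      using jump smooth by linarith
    also have "\<dots> = (V (Suc d) - V d) / real d"
    proof -
      have "harm d = harm (d - 1) + 1 / real d"
        using d by (cases d) (auto simp: harm_Suc inverse_eq_divide)
      then have "V (Suc d) - V d = 1 / real d + ?w" by (simp add: V_def)
      then show ?thesis by (simp add: add_divide_distrib)
    qed
    finally show ?thesis .
  qed
  have K_bounded: "\<bar>K d\<bar> \<le> 1" for d
  proof -
    have "y d = of_int \<lfloor>y d\<rfloor> + frac (y d)" by (simp add: frac_def)
    then have "K d = min (frac (y d)) \<alpha> - \<alpha> * frac (y d)"
      unfolding K_def phase_measure_def by (simp add: algebra_simps frac_def)
    moreover have "0 \<le> \<alpha> * frac (y d)" "\<alpha> * frac (y d) \<le> 1"
      using \<alpha> frac_lt_1[of "y d"] frac_ge_0[of "y d"] mult_le_one[of \<alpha> "frac (y d)"] by auto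
    moreover have "0 \<le> min (frac (y d)) \<alpha>" "min (frac (y d)) \<alpha> \<le> 1" using \<alpha> by auto
    ultimately show ?thesis by linarith
  qed
  have D_bound: "\<bar>D n\<bar> \<le> 2 * ln B + T n" for n
  proof -
    have "(\<Sum>d = 1..n. ln B * (K (Suc d) - K d)) = ln B * (K (Suc n) - K 1)"
      unfolding sum_distrib_left[symmetric] by (subst sum_Suc_diff) auto
    then have "\<bar>D n - ln B * (K (Suc n) - K 1)\<bar>
        = \<bar>\<Sum>d = 1..n. (h d - \<alpha>) / real d - ln B * (K (Suc d) - K d)\<bar>"
      by (simp add: D_def sum_subtractf)
    also have "\<dots> \<le> T n"
      unfolding T_def using increment by (intro order_trans[OF sum_abs] sum_mono) auto
    finally have "\<bar>D n - ln B * (K (Suc n) - K 1)\<bar> \<le> T n" .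
    moreover have "\<bar>ln B * (K (Suc n) - K 1)\<bar> \<le> ln B * 2"
      unfolding abs_mult using K_bounded[of "Suc n"] K_bounded[of 1] lnB
      by (intro mult_mono) auto
    ultimately show ?thesis by linarith
  qed
  have lim: "filterlim (\<lambda>n. harm n + 1 :: real) at_top sequentially"
    by (rule filterlim_at_top_mono[OF harm_at_top]) auto
  have "(\<lambda>n. T n / (harm n + 1)) \<longlonglongrightarrow> 0"
    unfolding T_def
  proof (rule sum_increments_div_smallo[OF _ _ lim])
    show "V n \<le> V (Suc n)" if "n \<ge> 1" for n
      unfolding V_def using phase_jumps_mono[OF y_mono[OF that]] by (intro add_mono harm_mono) auto
    show "V (Suc n) \<le> (2 / ln B + 1) * (harm n + 1)" for n
    proof -
      have "ln B * y (Suc n) = ln 2 + ln (real n + 1)"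
        using lnB ln_mult_pos[of 2 "real n + 1"] by (simp add: y_def log_def add.commute)
      also have "\<dots> \<le> 1 + harm n"
        using ln_le_harm[of n] ln_le_minus_one[of "2 :: real"] by simp
      finally have "y (Suc n) \<le> (harm n + 1) / ln B"
        using lnB by (simp add: field_simps)
      moreover have "phase_jumps \<alpha> (y (Suc n)) \<le> 2 * y (Suc n) + 1"
        unfolding phase_jumps_def using \<alpha> by linarith
      ultimately have "V (Suc n) \<le> 2 * ((harm n + 1) / ln B) + (harm n + 1)"
        by (simp only: V_def diff_Suc_1)
      then show ?thesis by (simp add: distrib_right)
    qed
  qed
  moreover have "(\<lambda>n. 2 * ln B / (harm n + 1)) \<longlonglongrightarrow> 0"
    by (rule real_tendsto_divide_at_top[OF tendsto_const lim])
  ultimately have "(\<lambda>n. 2 * ln B / (harm n + 1) + T n / (harm n + 1)) \<longlonglongrightarrow> 0"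
    using tendsto_add[of _ 0 sequentially _ 0] by simp
  then have "(\<lambda>n. D n / (harm n + 1)) \<longlonglongrightarrow> 0"
  proof (rule Lim_null_comparison[rotated], intro always_eventually allI)
    fix n
    have "\<bar>D n\<bar> / (harm n + 1) \<le> (2 * ln B + T n) / (harm n + 1)"
      using D_bound[of n] harm_nonneg[of n, where 'a = real] by (intro divide_right_mono) auto
    then show "norm (D n / (harm n + 1)) \<le> 2 * ln B / (harm n + 1) + T n / (harm n + 1)"
      using harm_nonneg[of n, where 'a = real] by (simp add: add_divide_distrib)
  qed
  moreover have "D n = (\<Sum>d = 1..n. (of_bool (significand B (2 * real d) \<le> s) - log B s) / real d)" for n
    unfolding D_def using assms significand_le_iff[of B _ s]
    by (intro sum.cong refl) (auto simp: h_def y_def \<alpha>_def)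
  ultimately show ?thesis by simp
qed

section \<open>Strong Benford behaviour\<close>

lemma significand_proportion_bounds:
  "0 \<le> significand_proportion B s ls" "significand_proportion B s ls \<le> 1"
  by (auto simp: significand_proportion_def divide_le_eq_1 length_filter_le)

lemma significand_proportion_mult_length:
  "significand_proportion B s ls * real (length ls)
    = sum_list (map (\<lambda>l. of_bool (significand B (real l) \<le> s)) ls)"
proof -
  have "real (length (filter P ls)) = sum_list (map (\<lambda>l. of_bool (P l)) ls)" for P
    by (induction ls) auto
  then show ?thesis by (cases "ls = []") (auto simp: significand_proportion_def)
qed

text \<open>
  The quotient is dealt with without dividing by the random number $N$ of sticks: because of
  $(P - \alpha)w = (PN - \alpha w) - P(N - w)$ and $0 \le P \le 1$, it suffices to control the
  deviations of $PN$ and of $N$ from constants.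
\<close>

lemma significand_proportion_deviation:
  fixes \<alpha> w :: real
  assumes "w > 0"
  shows "(significand_proportion B s ls - \<alpha>)\<^sup>2
    \<le> (2 * (sum_list (map (\<lambda>l. of_bool (significand B (real l) \<le> s)) ls) - \<alpha> * w)\<^sup>2
        + 2 * (real (length ls) - w)\<^sup>2) / w\<^sup>2"
proof -
  let ?P = "significand_proportion B s ls" and ?N = "real (length ls)"
  have "((?P - \<alpha>) * w)\<^sup>2 = ((?P * ?N - \<alpha> * w) - ?P * (?N - w))\<^sup>2"
    by (simp add: algebra_simps)
  also have "\<dots> \<le> 2 * (?P * ?N - \<alpha> * w)\<^sup>2 + 2 * (?P * (?N - w))\<^sup>2"
  proof -
    have "(x - y)\<^sup>2 \<le> 2 * x\<^sup>2 + 2 * y\<^sup>2" for x y :: real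
      using zero_le_power2[of "x + y"] by (simp add: power2_sum power2_diff)
    then show ?thesis .
  qed
  also have "(?P * (?N - w))\<^sup>2 \<le> 1 * (?N - w)\<^sup>2"
    unfolding power_mult_distrib using significand_proportion_bounds[of B s ls]
    by (intro mult_right_mono) (auto simp: power_le_one)
  finally show ?thesis
    using assms unfolding significand_proportion_mult_length[symmetric]
    by (simp add: power_mult_distrib pos_le_divide_eq)
qed

lemma dead_sticks_proportion_second_moment:
  assumes S: "S = {1} \<union> {2 * m | m. m > 0}" and "odd L"
  defines "n \<equiv> L div 2"
  shows "measure_pmf.expectation (dead_sticks S L) (\<lambda>ls. (significand_proportion B s ls - \<alpha>)\<^sup>2)
    \<le> 2 * ((of_bool (significand B 1 \<le> s) - \<alpha>) / (harm n + 1)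
        + (\<Sum>d = 1..n. (of_bool (significand B (2 * real d) \<le> s) - \<alpha>) / real d) / (harm n + 1))\<^sup>2
      + 12 / (harm n + 1)"
proof -
  define w :: real where "w = harm n + 1"
  have w: "w > 0" and harm_le: "harm n \<le> w"
    using harm_nonneg[of n, where 'a = real] by (auto simp: w_def)
  define b where "b l = (of_bool (significand B (real l) \<le> s) :: real)" for l :: nat
  let ?E = "measure_pmf.expectation (dead_sticks S L)"
  let ?A = "\<lambda>ls. (sum_list (map b ls) - \<alpha> * w)\<^sup>2" and ?N = "\<lambda>ls :: nat list. (real (length ls) - w)\<^sup>2"
  define e where "e = b 1 - \<alpha> + (\<Sum>d = 1..n. (b (2 * d) - \<alpha>) / real d)"
  have fin: "finite (set_pmf (dead_sticks S L))"
    unfolding dead_sticks_def using S odd_pos[OF \<open>odd L\<close>] by (intro finite_set_sticks_at_level) auto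
  note [simp] = integrable_measure_pmf_finite[OF fin]
  have "b 1 + (\<Sum>d = 1..n. b (2 * d) / real d) - \<alpha> * w = e"
    by (simp add: e_def w_def harm_def sum_subtractf diff_divide_distrib sum_distrib_left
        inverse_eq_divide algebra_simps)
  then have A: "?E ?A \<le> e\<^sup>2 + 3 * w"
    using dead_sticks_second_moment[OF S _ _ \<open>odd L\<close>, of b "\<alpha> * w"] harm_le
    by (simp add: b_def n_def)
  have N: "?E ?N \<le> 3 * w"
    using dead_sticks_second_moment[OF S _ _ \<open>odd L\<close>, of "\<lambda>_. 1" w] harm_le
    by (simp add: w_def n_def harm_def sum_list_triv inverse_eq_divide)
  have "?E (\<lambda>ls. (significand_proportion B s ls - \<alpha>)\<^sup>2) \<le> ?E (\<lambda>ls. (2 * ?A ls + 2 * ?N ls) / w\<^sup>2)"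
    unfolding b_def by (intro expectation_mono_finite fin significand_proportion_deviation w)
  also have "\<dots> = (2 * ?E ?A + 2 * ?E ?N) / w\<^sup>2"
    by simp
  also have "\<dots> \<le> (2 * (e\<^sup>2 + 3 * w) + 2 * (3 * w)) / w\<^sup>2"
    using A N by (intro divide_right_mono) auto
  also have "\<dots> = 2 * (e / w)\<^sup>2 + 12 / w"
    using w by (simp add: power_divide power2_eq_square field_simps)
  finally show ?thesis
    by (simp add: e_def b_def w_def add_divide_distrib)
qed

theorem theorem1p12:
  fixes B :: real and S :: "nat set"
  assumes "B > 1" and "S = {1} \<union> {2 * m | m. m > 0}"
  shows "\<forall>s \<in> {1..<B}.
    ((\<lambda>L. measure_pmf.expectation (dead_sticks S L) (significand_proportion B s))
        \<longlongrightarrow> log B s) (inf sequentially (principal {L. odd L \<and> L > 1})) \<and>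
    ((\<lambda>L. measure_pmf.variance (dead_sticks S L) (significand_proportion B s))
        \<longlongrightarrow> 0) (inf sequentially (principal {L. odd L \<and> L > 1}))"
proof
  fix s assume s: "s \<in> {1..<B}"
  let ?F = "inf sequentially (principal {L :: nat. odd L \<and> L > 1})"
  define \<alpha> where "\<alpha> = log B s"
  define X where "X = significand_proportion B s"
  define E :: "nat \<Rightarrow> (nat list \<Rightarrow> real) \<Rightarrow> real"
    where "E L = measure_pmf.expectation (dead_sticks S L)" for L
  define M where "M L = E L (\<lambda>ls. (X ls - \<alpha>)\<^sup>2)" for L
  define r where "r n = 2 * ((of_bool (significand B 1 \<le> s) - \<alpha>) / (harm n + 1)
      + (\<Sum>d = 1..n. (of_bool (significand B (2 * real d) \<le> s) - \<alpha>) / real d) / (harm n + 1))\<^sup>2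
      + 12 / (harm n + 1)" for n
  have odd: "\<forall>\<^sub>F L in ?F. odd L"
    by (auto simp: eventually_inf_principal)
  have lim: "filterlim (\<lambda>n. harm n + 1 :: real) at_top sequentially"
    by (rule filterlim_at_top_mono[OF harm_at_top]) auto
  have "r \<longlonglongrightarrow> 2 * (0 + 0)\<^sup>2 + 0"
    unfolding r_def \<alpha>_def
    by (intro tendsto_intros real_tendsto_divide_at_top[OF tendsto_const lim]
        significand_log_density assms(1) s)
  then have r: "r \<longlonglongrightarrow> 0" by simp
  have "filterlim (\<lambda>L :: nat. L div 2) sequentially sequentially"
    by (rule filterlim_at_top_div_const_nat) simp
  then have r_lim: "((\<lambda>L. r (L div 2)) \<longlongrightarrow> 0) ?F"
    by (intro tendsto_mono[OF inf_le1] filterlim_compose[OF r])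
  have M_lim: "(M \<longlongrightarrow> 0) ?F"
  proof (rule tendsto_sandwich[OF _ _ tendsto_const r_lim])
    show "\<forall>\<^sub>F L in ?F. 0 \<le> M L" by (simp add: M_def E_def)
    show "\<forall>\<^sub>F L in ?F. M L \<le> r (L div 2)"
      unfolding M_def E_def X_def r_def
      using odd by eventually_elim (rule dead_sticks_proportion_second_moment[OF assms(2)])
  qed
  \<comment> \<open>Mean square error is variance plus squared bias, so both are squeezed to 0.\<close>
  have decomp: "M L = E L (\<lambda>ls. (X ls - E L X)\<^sup>2) + (E L X - \<alpha>)\<^sup>2" if "odd L" for L
  proof -
    have "finite (set_pmf (dead_sticks S L))"
      unfolding dead_sticks_def using assms(2) odd_pos[OF \<open>odd L\<close>]
      by (intro finite_set_sticks_at_level) auto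
    note [simp] = integrable_measure_pmf_finite[OF this]
    have "M L = E L (\<lambda>ls. (X ls - E L X)\<^sup>2 + 2 * (E L X - \<alpha>) * (X ls - E L X) + (E L X - \<alpha>)\<^sup>2)"
      unfolding M_def by (intro arg_cong[where f = "E L"] ext) (simp add: power2_eq_square algebra_simps)
    also have "\<dots> = E L (\<lambda>ls. (X ls - E L X)\<^sup>2) + 2 * (E L X - \<alpha>) * (E L X - E L X)
        + (E L X - \<alpha>)\<^sup>2"
      unfolding E_def by simp
    finally show ?thesis by simp
  qed
  have nonneg: "0 \<le> E L (\<lambda>ls. (X ls - E L X)\<^sup>2)" for L
    by (simp add: E_def)
  have "((\<lambda>L. E L (\<lambda>ls. (X ls - E L X)\<^sup>2)) \<longlongrightarrow> 0) ?F"
    by (rule tendsto_sandwich[OF _ _ tendsto_const M_lim])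
       (use odd nonneg decomp in \<open>auto elim!: eventually_mono\<close>)
  moreover have "((\<lambda>L. E L X) \<longlongrightarrow> \<alpha>) ?F"
  proof -
    have "((\<lambda>L. (E L X - \<alpha>)\<^sup>2) \<longlongrightarrow> 0) ?F"
      by (rule tendsto_sandwich[OF _ _ tendsto_const M_lim])
         (use odd nonneg decomp in \<open>auto elim!: eventually_mono\<close>)
    then have "((\<lambda>L. \<bar>E L X - \<alpha>\<bar>) \<longlongrightarrow> 0) ?F"
      using tendsto_real_sqrt[of _ 0] by fastforce
    then show ?thesis
      by (simp add: tendsto_rabs_zero_iff LIM_zero_iff)
  qed
  ultimately show "((\<lambda>L. measure_pmf.expectation (dead_sticks S L) (significand_proportion B s))
        \<longlongrightarrow> log B s) ?F \<and>
    ((\<lambda>L. measure_pmf.variance (dead_sticks S L) (significand_proportion B s)) \<longlongrightarrow> 0) ?F"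
    by (simp add: E_def X_def \<alpha>_def)
qed

end
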